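(* Let $0\le\alpha<1$, let $n\ge 2$ be an integer, and let $c\in\mathbb{C}$. If one of the following conditions holds: (i) $\frac{1}{\alpha+n(1-\alpha)}<|c|<1$; (ii) $n>\frac{3-\alpha}{1-\alpha}$ and $\frac{1}{\alpha-2+n(1-\alpha)}<|c|<1$; (iii) $n\ge\frac{2-\alpha}{1-\alpha}$ and $|c|>1$; (iv) $n<\frac{2-\alpha}{1-\alpha}$ and $1<|c|<\frac{1}{2-\alpha+n(\alpha-1)}$; then the function $g_n(z)=z+cz^n$ does not belong to the class $\mathcal{BS}(\alpha)$.
   Context: $\Delta=\{z\in\mathbb{C}:|z|<1\}$, and $\mathcal{A}$ is the class of analytic functions $f$ on $\Delta$ with $f(0)=0$ and $f'(0)=1$. For analytic functions $f,g$ on $\Delta$, $f\prec g$ ($f$ is subordinate to $g$) means that there is an analytic function $w$ on $\Delta$ with $w(0)=0$ and $|w(z)|<1$ for all $z\in\Delta$ such that $f(z)=g(w(z))$ for all $z\in\Delta$. For $0\le\alpha<1$, $\mathcal{BS}(\alpha)$ is the class of $f\in\mathcal{A}$ such that $\frac{zf'(z)}{f(z)}-1\prec\frac{z}{1-\alpha z^2}$ in $\Delta$ (in particular $zf'(z)/f(z)$ is required to be analytic in $\Delta$, with value $1$ at $z=0$). *)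

theory Defs
  imports "HOL-Complex_Analysis.Complex_Analysis"
begin

text \<open>Functions on the unit disc are total functions on the complex plane of which only the
  values on \<open>\<Delta>\<close> matter.\<close>

abbreviation unit_disc :: "complex set" ("\<Delta>")
  where "\<Delta> \<equiv> ball 0 1"

definition class_A :: "(complex \<Rightarrow> complex) set" ("\<A>")
  where "\<A> = {f. f analytic_on \<Delta> \<and> f 0 = 0 \<and> deriv f 0 = 1}"

definition subordinate :: "(complex \<Rightarrow> complex) \<Rightarrow> (complex \<Rightarrow> complex) \<Rightarrow> bool" (infix "\<prec>" 50)
  where "f \<prec> g \<longleftrightarrow> f analytic_on \<Delta> \<and> g analytic_on \<Delta> \<and>
    (\<exists>w. w analytic_on \<Delta> \<and> w 0 = 0 \<and> (\<forall>z\<in>\<Delta>. norm (w z) < 1) \<and> (\<forall>z\<in>\<Delta>. f z = g (w z)))"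

text \<open>The quotient \<open>z f'(z) / f(z)\<close> is undefined at the zeros of \<open>f\<close>, in particular at \<open>0\<close>, where
  division in HOL would return \<open>0\<close>. That it is analytic in \<open>\<Delta>\<close> with value \<open>1\<close> at \<open>0\<close> is expressed
  by an analytic function \<open>h\<close> on \<open>\<Delta>\<close> that agrees with it wherever \<open>f\<close> does not vanish; as the zeros
  of \<open>f \<in> \<A>\<close> are isolated, \<open>h\<close> is unique on \<open>\<Delta>\<close>.\<close>

definition class_BS :: "real \<Rightarrow> (complex \<Rightarrow> complex) set" ("\<B>\<S>")
  where "\<B>\<S> \<alpha> = {f \<in> \<A>. \<exists>h. h analytic_on \<Delta> \<and> h 0 = 1 \<and>
    (\<forall>z\<in>\<Delta>. f z \<noteq> 0 \<longrightarrow> h z = z * deriv f z / f z) \<and>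
    (\<lambda>z. h z - 1) \<prec> (\<lambda>z. z / (1 - complex_of_real \<alpha> * z ^ 2))}"

end

theory Submission
  imports Defs
begin

text \<open>The function \<open>z / (1 - \<alpha> z\<^sup>2)\<close> maps the disc into the open disc of radius \<open>1 / (1 - \<alpha>)\<close>,
  and subordination passes this bound on to \<open>z f'(z) / f(z) - 1\<close> for every \<open>f\<close> in \<open>\<B>\<S>(\<alpha>)\<close>.
  For \<open>f(z) = z + c z\<^sup>n\<close> this quotient is \<open>(n - 1) u / (1 + u)\<close> with \<open>u = c z\<^sup>n\<^sup>-\<^sup>1\<close>, and \<open>u\<close> runs
  through the disc of radius \<open>\<bar>c\<bar>\<close>. At \<open>u = -r\<close> with \<open>0 < r < 1\<close> its modulus is
  \<open>(n - 1) r / (1 - r)\<close>, which attains the forbidden value \<open>1 / (1 - \<alpha>)\<close> exactly for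
  \<open>r = 1 / (\<alpha> + n (1 - \<alpha>))\<close>.
  So \<open>\<bar>c\<bar> > r\<close> alone excludes membership (\<open>binomial_notin_class_BS\<close>), and each of the four
  conditions implies it. Under (ii), the bound on \<open>\<bar>c\<bar>\<close> has a smaller positive denominator
  than \<open>r\<close> does; under (iii) and (iv), \<open>\<bar>c\<bar> > 1 > r\<close>.\<close>

text \<open>The triangle inequality gives
  \<open>\<bar>1 - \<alpha> w\<^sup>2\<bar> \<ge> 1 - \<alpha> \<bar>w\<bar>\<^sup>2 \<ge> 1 - \<alpha> > \<bar>w\<bar> (1 - \<alpha>)\<close>.\<close>

lemma norm_booth_less:
  fixes \<alpha> :: real and w :: complex
  assumes "0 \<le> \<alpha>" and "\<alpha> < 1" and "norm w < 1"
  shows "norm (w / (1 - complex_of_real \<alpha> * w ^ 2)) < 1 / (1 - \<alpha>)"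
proof -
  have "(norm w)\<^sup>2 \<le> 1"
    using assms(3) by (simp add: power_le_one)
  then have "\<alpha> * (norm w)\<^sup>2 \<le> \<alpha>"
    using assms(1) by (simp add: mult_left_le)
  moreover have "1 - \<alpha> * (norm w)\<^sup>2 \<le> norm (1 - complex_of_real \<alpha> * w ^ 2)"
    using norm_triangle_ineq2[of 1 "complex_of_real \<alpha> * w ^ 2"] assms(1)
    by (simp add: norm_mult norm_power)
  ultimately have den: "1 - \<alpha> \<le> norm (1 - complex_of_real \<alpha> * w ^ 2)"
    by linarith
  have "norm w * (1 - \<alpha>) < 1 - \<alpha>"
    using assms by simp
  then have "norm w * (1 - \<alpha>) < norm (1 - complex_of_real \<alpha> * w ^ 2)"
    using den by (rule less_le_trans)
  then show ?thesis
    using den assms(2) by (simp add: norm_divide divide_simps)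
qed

lemma class_BS_norm_less:
  assumes "f \<in> \<B>\<S> \<alpha>" and "0 \<le> \<alpha>" and "\<alpha> < 1" and "z \<in> \<Delta>" and "f z \<noteq> 0"
  shows "norm (z * deriv f z / f z - 1) < 1 / (1 - \<alpha>)"
proof -
  from assms(1) obtain h where
    h: "\<And>z. z \<in> \<Delta> \<Longrightarrow> f z \<noteq> 0 \<Longrightarrow> h z = z * deriv f z / f z" and
    sub: "(\<lambda>z. h z - 1) \<prec> (\<lambda>z. z / (1 - complex_of_real \<alpha> * z ^ 2))"
    unfolding class_BS_def by blast
  from sub obtain w where w: "\<forall>z\<in>\<Delta>. norm (w z) < 1"
    "\<forall>z\<in>\<Delta>. h z - 1 = w z / (1 - complex_of_real \<alpha> * (w z) ^ 2)"
    unfolding subordinate_def by blast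
  have "norm (h z - 1) < 1 / (1 - \<alpha>)"
    using norm_booth_less[OF assms(2,3)] w assms(4) by simp
  then show ?thesis
    using h[OF assms(4,5)] by simp
qed

lemma complex_root_in_disc:
  fixes a :: complex
  assumes "a \<noteq> 0" and "norm a < 1" and "0 < m"
  obtains z where "z \<in> \<Delta>" and "z \<noteq> 0" and "z ^ m = a"
proof -
  define z where "z = exp (ln a / of_nat m)"
  have pow: "z ^ m = a"
    using assms(1,3) by (simp add: z_def exp_of_nat_mult[symmetric])
  have "norm z < 1"
  proof (rule ccontr)
    assume "\<not> norm z < 1"
    then have "1 \<le> norm z ^ m"
      by (simp add: one_le_power)
    then show False
      using pow assms(2) by (metis norm_power not_less)
  qed
  then show ?thesis
    using that[of z] pow by (simp add: z_def)
qed

text \<open>The four conditions on \<open>\<bar>c\<bar>\<close> have this single lower bound as their common consequence.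
  It says that \<open>c z\<^sup>n\<^sup>-\<^sup>1\<close> takes the critical value \<open>-r\<close> in the disc.\<close>

lemma binomial_notin_class_BS:
  fixes \<alpha> :: real and n :: nat and c :: complex
  assumes "0 \<le> \<alpha>" and "\<alpha> < 1" and "n \<ge> 2"
    and c: "1 / (\<alpha> + real n * (1 - \<alpha>)) < norm c"
  shows "(\<lambda>z. z + c * z ^ n) \<notin> \<B>\<S> \<alpha>"
proof
  let ?f = "\<lambda>z. z + c * z ^ n"
  assume mem: "?f \<in> \<B>\<S> \<alpha>"
  define d where "d = \<alpha> + real n * (1 - \<alpha>)"
  define r where "r = 1 / d"
  have d: "d - 1 = (real n - 1) * (1 - \<alpha>)"
    by (simp add: d_def algebra_simps)
  have "0 < (real n - 1) * (1 - \<alpha>)"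
    using assms(2,3) by simp
  then have d1: "1 < d"
    using d by linarith
  then have r: "0 < r" "r < 1"
    by (simp_all add: r_def)
  have rc: "r < norm c"
    using c by (simp add: r_def d_def)
  then have "c \<noteq> 0"
    using r by auto
  obtain z where z: "z \<in> \<Delta>" "z \<noteq> 0" "z ^ (n - 1) = - of_real r / c"
  proof (rule complex_root_in_disc)
    show "- of_real r / c \<noteq> 0"
      using r \<open>c \<noteq> 0\<close> by simp
    show "norm (- of_real r / c) < 1"
      using r rc \<open>c \<noteq> 0\<close> by (simp add: norm_divide)
    show "0 < n - 1"
      using assms(3) by simp
  qed
  then have u: "c * z ^ (n - 1) = - of_real r"
    using \<open>c \<noteq> 0\<close> by simp
  have "z ^ n = z * z ^ (n - 1)"
    using assms(3) by (metis One_nat_def Suc_1 Suc_le_D diff_Suc_1 power_Suc)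
  then have "?f z = z * (1 + c * z ^ (n - 1))"
    by (simp only: distrib_left mult_1_right mult.left_commute)
  then have fz: "?f z = z * of_real (1 - r)"
    unfolding u by simp
  have "deriv ?f z = 1 + of_nat n * (c * z ^ (n - 1))"
    by (rule DERIV_imp_deriv) (auto intro!: derivative_eq_intros)
  then have f'z: "deriv ?f z = of_real (1 - real n * r)"
    using u by simp
  \<comment> \<open>Since \<open>d - 1 = (n - 1) (1 - \<alpha>)\<close>, the point \<open>u = -1 / d\<close> makes the quotient extremal.\<close>
  have val: "(1 - real n * r) / (1 - r) - 1 = - (1 / (1 - \<alpha>))"
  proof -
    have "(1 - real n * r) / (1 - r) = (d - real n) / (d - 1)"
      using d1 by (simp add: r_def field_simps)
    also have "\<dots> - 1 = - ((real n - 1) / (d - 1))"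
      using d1 by (simp add: field_simps)
    also have "\<dots> = - (1 / (1 - \<alpha>))"
      using assms(2,3) by (simp add: d)
    finally show ?thesis .
  qed
  have "z * deriv ?f z / ?f z - 1 = of_real ((1 - real n * r) / (1 - r) - 1)"
    unfolding fz f'z using z(2) by simp
  then have "norm (z * deriv ?f z / ?f z - 1) = 1 / (1 - \<alpha>)"
    unfolding val using assms(2) by (simp del: of_real_minus of_real_divide)
  moreover have "?f z \<noteq> 0"
    unfolding fz using z(2) r by (simp del: of_real_diff)
  ultimately show False
    using class_BS_norm_less[OF mem assms(1,2) z(1)] by simp
qed

theorem theorem2p3:
  fixes \<alpha> :: real and n :: nat and c :: complex
  assumes "0 \<le> \<alpha>" and "\<alpha> < 1" and "n \<ge> 2"
    and "(1 / (\<alpha> + real n * (1 - \<alpha>)) < norm c \<and> norm c < 1)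
       \<or> (real n > (3 - \<alpha>) / (1 - \<alpha>) \<and>
            1 / (\<alpha> - 2 + real n * (1 - \<alpha>)) < norm c \<and> norm c < 1)
       \<or> (real n \<ge> (2 - \<alpha>) / (1 - \<alpha>) \<and> norm c > 1)
       \<or> (real n < (2 - \<alpha>) / (1 - \<alpha>) \<and>
            1 < norm c \<and> norm c < 1 / (2 - \<alpha> + real n * (\<alpha> - 1)))"
  shows "(\<lambda>z. z + c * z ^ n) \<notin> \<B>\<S> \<alpha>"
proof (rule binomial_notin_class_BS[OF assms(1-3)])
  let ?d = "\<alpha> + real n * (1 - \<alpha>)"
  have "0 < (real n - 1) * (1 - \<alpha>)"
    using assms(2,3) by simp
  then have "1 < ?d"
    by (simp add: algebra_simps)
  then have le1: "1 / ?d < 1"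
    by simp
  have ii: "1 / ?d \<le> 1 / (\<alpha> - 2 + real n * (1 - \<alpha>))" if "real n > (3 - \<alpha>) / (1 - \<alpha>)"
  proof -
    have "3 - \<alpha> < real n * (1 - \<alpha>)"
      using that assms(2) by (simp add: pos_divide_less_eq)
    then show ?thesis
      by (intro divide_left_mono mult_pos_pos) auto
  qed
  show "1 / ?d < norm c"
    using assms(4) le1 ii by linarith
qed

end
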